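(* Let $\mathbf{x}\in L^2(\mathbb{R})$, $k\in\mathbb{Q}^+$ and $\theta\in\mathbb{R}$ with $\theta\notin\pi\mathbb{Z}$. Let $\mathbf{h}(t)=e^{-i\frac{\cot\theta}{2}t^2}\mathbf{x}(t)$. Then for $\tau,u\in\mathbb{R}$, $$\mathcal{A}^{\theta,k}_{\mathbf{h}}(\tau,u)=|\Omega_\theta|^2\,\mathcal{A}^{k}_{\mathbf{x}}(\tau,u\csc\theta).$$
   Context: Superscript $*$ denotes complex conjugation. $\Omega_\theta=\sqrt{(1-i\cot\theta)/2\pi}$, so $|\Omega_\theta|^2=|\csc\theta|/(2\pi)$. The new fractional ambiguity function (NFrAF) of $\mathbf{x}\in L^2(\mathbb{R})$ with parameters $(\theta,k)$ is $$\mathcal{A}^{\theta,k}_{\mathbf{x}}(\tau,u)=|\Omega_\theta|^2\int_{\mathbb{R}}\mathbf{x}\left(t+k\tfrac{\tau}{2}\right)\mathbf{x}^*\left(t-k\tfrac{\tau}{2}\right)e^{it(k\tau\cot\theta-u\csc\theta)}\,dt.$$ The scaled ambiguity function (SAF) of $\mathbf{x}$ is $$\mathcal{A}^{k}_{\mathbf{x}}(\tau,u)=\int_{\mathbb{R}}\mathbf{x}\left(t+k\tfrac{\tau}{2}\right)\mathbf{x}^*\left(t-k\tfrac{\tau}{2}\right)e^{-iut}\,dt.$$ *)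

theory Defs
  imports "HOL-Analysis.Analysis"
begin

text \<open>
  Elements of \<open>L\<^sup>2(\<real>)\<close> are represented by Lebesgue measurable, square-integrable functions.
\<close>
definition L2_real :: "(real \<Rightarrow> complex) set" where
  "L2_real = {x \<in> borel_measurable lebesgue. integrable lebesgue (\<lambda>t. (cmod (x t))\<^sup>2)}"

definition csc :: "real \<Rightarrow> real" where
  "csc \<theta> = 1 / sin \<theta>"

definition Omega :: "real \<Rightarrow> complex" where
  "Omega \<theta> = csqrt ((1 - \<i> * complex_of_real (cot \<theta>)) / (2 * complex_of_real pi))"

definition NFrAF :: "real \<Rightarrow> real \<Rightarrow> (real \<Rightarrow> complex) \<Rightarrow> real \<Rightarrow> real \<Rightarrow> complex" where
  "NFrAF \<theta> k x \<tau> u =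
     complex_of_real ((cmod (Omega \<theta>))\<^sup>2) *
     (LINT t|lebesgue. x (t + k * (\<tau> / 2)) * cnj (x (t - k * (\<tau> / 2))) *
        exp (\<i> * complex_of_real (t * (k * \<tau> * cot \<theta> - u * csc \<theta>))))"

definition SAF :: "real \<Rightarrow> (real \<Rightarrow> complex) \<Rightarrow> real \<Rightarrow> real \<Rightarrow> complex" where
  "SAF k x \<tau> u =
     (LINT t|lebesgue. x (t + k * (\<tau> / 2)) * cnj (x (t - k * (\<tau> / 2))) *
        exp (- \<i> * complex_of_real (u * t)))"

end

theory Submission
  imports Defs
begin

text \<open>
  The two integrands agree at every point. With \<open>a = k \<tau> / 2\<close>, the chirp factors of
  \<open>h (t + a)\<close> and \<open>cnj (h (t - a))\<close> have total phase
  \<open>- (cot \<theta> / 2) ((t + a)\<^sup>2 - (t - a)\<^sup>2) = - t k \<tau> cot \<theta>\<close>, which cancels the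
  \<open>cot \<theta>\<close> part of the kernel and leaves \<open>- u t csc \<theta>\<close>.
\<close>

theorem mainTheorem8:
  fixes x h :: "real \<Rightarrow> complex" and k \<theta> \<tau> u :: real
  assumes "x \<in> L2_real"
    and "k \<in> \<rat>" and "k > 0"
    and "\<not> (\<exists>n::int. \<theta> = of_int n * pi)"
    and "\<And>t. h t = exp (- \<i> * complex_of_real (cot \<theta> / 2 * t\<^sup>2)) * x t"
  shows "NFrAF \<theta> k h \<tau> u =
    complex_of_real ((cmod (Omega \<theta>))\<^sup>2) * SAF k x \<tau> (u * csc \<theta>)"
proof -
  define a c where "a = k * (\<tau> / 2)" and "c = cot \<theta>"
  have "h (t + a) * cnj (h (t - a)) * exp (\<i> * complex_of_real (t * (k * \<tau> * c - u * csc \<theta>)))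
      = x (t + a) * cnj (x (t - a)) * exp (- \<i> * complex_of_real (u * csc \<theta> * t))" for t
  proof -
    have phase: "exp (- \<i> * complex_of_real (c / 2 * (t + a)\<^sup>2)) *
        exp (\<i> * complex_of_real (c / 2 * (t - a)\<^sup>2)) *
        exp (\<i> * complex_of_real (t * (k * \<tau> * c - u * csc \<theta>)))
      = exp (- \<i> * complex_of_real (u * csc \<theta> * t))"
      unfolding exp_add[symmetric] a_def
      by (rule arg_cong[where f = exp]) (simp add: complex_eq_iff power2_eq_square field_simps)
    have conj: "cnj (exp (- \<i> * complex_of_real (c / 2 * (t - a)\<^sup>2)))
        = exp (\<i> * complex_of_real (c / 2 * (t - a)\<^sup>2))"
      by (simp add: exp_cnj)
    show ?thesis
      unfolding assms(5) c_def[symmetric] complex_cnj_mult conj phase[symmetric]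
      by (simp only: mult_ac)
  qed
  then show ?thesis
    unfolding NFrAF_def SAF_def a_def c_def by simp
qed

end
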